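(* Suppose that $S$ is a $p\times p$ positive definite matrix, $n\ge 1$, $\pi$ is bounded, and $\pi_D$ satisfies $\limsup_{x\to\infty}\pi_D(x)<\infty$ and $\int_0^1 x^{(n+p-1)/2}\pi_D(x)\,dx<\infty$. Then the posterior $p(\Theta\mid S)$ is proper.
   Context: Fix an integer $p\ge 1$; $n$ is a positive integer (the sample size). All matrices are real symmetric $p\times p$, and $\Theta=(\theta_{ij})\succ 0$ means $\Theta$ is positive definite. The functions $\pi_D:(0,\infty)\to[0,\infty)$ and $\pi:\mathbb{R}\to[0,\infty)$ are continuous. They define the (possibly improper) separable prior $$p(\Theta)\propto\prod_{i=1}^p\pi_D(\theta_{ii})\prod_{i<j}\pi(\theta_{ij})\,\mathbb{I}(\Theta\succ 0),$$ and the posterior given $S$ is $$p(\Theta\mid S)\propto\det(\Theta)^{n/2}\exp\!\left(-\frac n2\mathrm{tr}(S\Theta)\right)\prod_{i=1}^p\pi_D(\theta_{ii})\prod_{i<j}\pi(\theta_{ij})\,\mathbb{I}(\Theta\succ 0).$$ The posterior is called proper if this unnormalised density has finite integral over the cone of positive definite matrices with respect to Lebesgue measure $d\Theta=\prod_{i\le j}d\theta_{ij}$ on the upper triangular entries. *)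

theory Defs
  imports "HOL-Analysis.Analysis"
begin

text \<open>
  Matrices are indexed by a finite linearly ordered type \<open>'p\<close>, so that the dimension
  is \<open>CARD('p)\<close> and \<open>i < j\<close>, \<open>i \<le> j\<close> make sense for indices.
\<close>

type_synonym 'p sqmat = "((real, 'p) vec, 'p) vec"

definition pos_definite :: "'p::finite sqmat \<Rightarrow> bool" where
  "pos_definite A \<longleftrightarrow> transpose A = A \<and> (\<forall>x. x \<noteq> 0 \<longrightarrow> x \<bullet> (A *v x) > 0)"

definition upper_tri :: "('p::{finite,linorder} \<times> 'p) set" where
  "upper_tri = {(i, j). i \<le> j}"

definition sym_matrix :: "('p::{finite,linorder} \<times> 'p \<Rightarrow> real) \<Rightarrow> 'p::{finite,linorder} sqmat" where
  "sym_matrix \<theta> = (\<chi> i j. \<theta> (min i j, max i j))"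

definition upper_tri_lebesgue :: "('p::{finite,linorder} \<times> 'p \<Rightarrow> real) measure" where
  "upper_tri_lebesgue = (\<Pi>\<^sub>M k\<in>upper_tri. lborel)"

definition prior_density ::
    "(real \<Rightarrow> real) \<Rightarrow> (real \<Rightarrow> real) \<Rightarrow> 'p::{finite,linorder} sqmat \<Rightarrow> real" where
  "prior_density \<pi>D \<pi> \<Theta> =
     (\<Prod>i\<in>UNIV. \<pi>D (\<Theta> $ i $ i)) * (\<Prod>(i, j)\<in>{(i, j). i < j}. \<pi> (\<Theta> $ i $ j)) *
     indicator {A. pos_definite A} \<Theta>"

text \<open>
  Both densities are unnormalised. The values of \<open>\<pi>D\<close> outside \<open>(0,\<infinity>)\<close> are irrelevant:
  the diagonal of a positive definite matrix is positive.
\<close>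

definition posterior_density ::
    "nat \<Rightarrow> 'p::{finite,linorder} sqmat \<Rightarrow> (real \<Rightarrow> real) \<Rightarrow> (real \<Rightarrow> real) \<Rightarrow> 'p::{finite,linorder} sqmat \<Rightarrow> real" where
  "posterior_density n S \<pi>D \<pi> \<Theta> =
     det \<Theta> powr (real n / 2) * exp (- (real n / 2) * trace (S ** \<Theta>)) * prior_density \<pi>D \<pi> \<Theta>"

definition posterior_proper ::
    "nat \<Rightarrow> 'p::{finite,linorder} sqmat \<Rightarrow> (real \<Rightarrow> real) \<Rightarrow> (real \<Rightarrow> real) \<Rightarrow> bool" where
  "posterior_proper n S \<pi>D \<pi> \<longleftrightarrow>
     integrable upper_tri_lebesgue (\<lambda>\<theta>. posterior_density n S \<pi>D \<pi> (sym_matrix \<theta>))"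

end

theory Submission
  imports Defs
begin

text \<open>
  Let \<open>\<Theta>\<close> be positive definite. Its off-diagonal entries satisfy
  \<open>\<bar>\<theta>\<^sub>i\<^sub>j\<bar> \<le> sqrt (\<theta>\<^sub>i\<^sub>i \<theta>\<^sub>j\<^sub>j)\<close>, so the Leibniz formula gives \<open>det \<Theta> \<le> p! \<Prod>\<theta>\<^sub>i\<^sub>i\<close>; moreover
  \<open>tr (S\<Theta>) \<ge> c tr \<Theta>\<close> for some \<open>c > 0\<close>. Hence the posterior density is at most a constant times
  \<open>\<Prod> \<theta>\<^sub>i\<^sub>i\<^bsup>n/2\<^esup> exp (-n c \<theta>\<^sub>i\<^sub>i / 2) \<pi>D \<theta>\<^sub>i\<^sub>i\<close> on the set where all the entry bounds hold. Integrating the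
  off-diagonal entries over their intervals multiplies this by \<open>\<Prod> \<theta>\<^sub>i\<^sub>i\<^bsup>(p-1)/2\<^esup>\<close> up to a constant, and
  there remains a product of one-dimensional integrals
  \<open>\<integral> x\<^bsup>(n+p-1)/2\<^esup> exp (-n c x / 2) \<pi>D x dx\<close> over \<open>(0, \<infinity>)\<close>: the hypothesis controls them near \<open>0\<close>,
  the exponential at infinity.
\<close>

section \<open>Quadratic forms, entries and determinants of positive semidefinite matrices\<close>

lemma inner_matrix_vector_sum:
  fixes A :: "real^'n^'n"
  shows "x \<bullet> (A *v y) = (\<Sum>i\<in>UNIV. \<Sum>j\<in>UNIV. A $ i $ j * x $ i * y $ j)"
  by (simp add: inner_vec_def matrix_vector_mult_def sum_distrib_left mult_ac)

lemma inner_matrix_vector_sym: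
  fixes A :: "real^'n^'n"
  assumes "transpose A = A"
  shows "x \<bullet> (A *v y) = y \<bullet> (A *v x)"
  by (metis assms dot_lmul_matrix inner_commute transpose_matrix_vector)

lemma inner_axis_matrix_vector:
  fixes A :: "real^'n^'n"
  shows "axis i 1 \<bullet> (A *v axis j 1) = A $ i $ j"
  by (simp add: inner_axis' matrix_vector_mult_basis column_def)

text \<open>Discriminant argument for the quadratic polynomial
  \<open>t \<mapsto> (x + t y) \<bullet> A (x + t y)\<close>, which never becomes negative. As
  \<open>A\<close> is only semidefinite, the leading coefficient \<open>c\<close> may vanish and
  that case is separate.\<close>

lemma psd_cauchy_schwarz:
  fixes A :: "real^'n^'n"
  assumes sym: "transpose A = A" and psd: "\<And>x. 0 \<le> x \<bullet> (A *v x)"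
  shows "(x \<bullet> (A *v y))\<^sup>2 \<le> (x \<bullet> (A *v x)) * (y \<bullet> (A *v y))"
proof -
  define a b c where "a = x \<bullet> (A *v x)" and "b = x \<bullet> (A *v y)" and "c = y \<bullet> (A *v y)"
  have ac: "a \<ge> 0" "c \<ge> 0" using psd by (auto simp: a_def c_def)
  have q: "0 \<le> a + 2 * t * b + t\<^sup>2 * c" for t
  proof -
    have "0 \<le> (x + t *\<^sub>R y) \<bullet> (A *v (x + t *\<^sub>R y))" by (rule psd)
    also have "\<dots> = a + 2 * t * b + t\<^sup>2 * c"
      using inner_matrix_vector_sym[OF sym, of y x]
      by (simp add: a_def b_def c_def matrix_vector_right_distrib matrix_vector_mult_scaleR
          inner_add_left inner_add_right power2_eq_square algebra_simps)
    finally show ?thesis .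
  qed
  have "b\<^sup>2 \<le> a * c"
  proof (cases "c = 0")
    case True
    have "b = 0"
    proof (rule ccontr)
      assume "b \<noteq> 0"
      \<comment> \<open>With \<open>c = 0\<close> the polynomial is affine in \<open>t\<close>; this
        \<open>t\<close> makes its value \<open>-1\<close>.\<close>
      then show False using q[of "- (a + 1) / (2 * b)"] True by (simp add: field_simps)
    qed
    then show ?thesis using ac by simp
  next
    case False
    with ac have "c > 0" by simp
    \<comment> \<open>The value \<open>- b / c\<close> is the minimiser of the polynomial.\<close>
    have "0 \<le> a + 2 * (- b / c) * b + (- b / c)\<^sup>2 * c" by (rule q)
    also have "\<dots> = a - b\<^sup>2 / c"
      using \<open>c > 0\<close> by (simp add: field_simps power2_eq_square)
    finally show ?thesis using \<open>c > 0\<close> by (simp add: field_simps)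
  qed
  then show ?thesis by (simp add: a_def b_def c_def)
qed

lemma psd_entry_sq_le:
  fixes A :: "real^'n^'n"
  assumes "transpose A = A" and "\<And>x. 0 \<le> x \<bullet> (A *v x)"
  shows "(A $ i $ j)\<^sup>2 \<le> A $ i $ i * A $ j $ j"
  using psd_cauchy_schwarz[OF assms, of "axis i 1" "axis j 1"] by (simp add: inner_axis_matrix_vector)

lemma psd_diag_nonneg:
  fixes A :: "real^'n^'n"
  assumes "\<And>x. 0 \<le> x \<bullet> (A *v x)"
  shows "0 \<le> A $ i $ i"
  using assms[of "axis i 1"] by (simp add: inner_axis_matrix_vector)

lemma psd_abs_entry_le:
  fixes A :: "real^'n^'n"
  assumes "transpose A = A" and "\<And>x. 0 \<le> x \<bullet> (A *v x)"
  shows "\<bar>A $ i $ j\<bar> \<le> sqrt (A $ i $ i) * sqrt (A $ j $ j)"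
  using real_sqrt_le_mono[OF psd_entry_sq_le[OF assms, of i j]] by (simp add: real_sqrt_mult)

text \<open>A crude form of Hadamard's inequality. Since \<sigma> is a permutation, the factors
  \<open>sqrt (A $ i $ i)\<close> and \<open>sqrt (A $ \<sigma> i $ \<sigma> i)\<close> have the
  same product over \<open>i\<close>, so every Leibniz term obeys the same bound; the factorial
  counts the terms.\<close>

lemma psd_abs_det_le:
  fixes A :: "real^'n^'n"
  assumes "transpose A = A" and psd: "\<And>x. 0 \<le> x \<bullet> (A *v x)"
  shows "\<bar>det A\<bar> \<le> fact CARD('n) * (\<Prod>i\<in>UNIV. A $ i $ i)"
proof -
  have "\<bar>of_int (sign \<sigma>) * (\<Prod>i\<in>UNIV. A $ i $ \<sigma> i)\<bar> \<le> (\<Prod>i\<in>UNIV. A $ i $ i)"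
    if "\<sigma> permutes (UNIV :: 'n set)" for \<sigma>
  proof -
    have "\<bar>of_int (sign \<sigma>) * (\<Prod>i\<in>UNIV. A $ i $ \<sigma> i)\<bar> = (\<Prod>i\<in>UNIV. \<bar>A $ i $ \<sigma> i\<bar>)"
      by (simp add: abs_mult sign_def abs_prod)
    also have "\<dots> \<le> (\<Prod>i\<in>UNIV. sqrt (A $ i $ i) * sqrt (A $ \<sigma> i $ \<sigma> i))"
      by (intro prod_mono conjI psd_abs_entry_le assms) auto
    also have "\<dots> = (\<Prod>i\<in>UNIV. sqrt (A $ i $ i)) * (\<Prod>i\<in>UNIV. sqrt (A $ i $ i))"
      using prod.permute[OF that, of "\<lambda>i. sqrt (A $ i $ i)"] by (simp add: prod.distrib o_def)
    also have "\<dots> = (\<Prod>i\<in>UNIV. A $ i $ i)"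
      using psd_diag_nonneg[OF psd] by (simp flip: prod.distrib)
    finally show ?thesis .
  qed
  then have "\<bar>det A\<bar> \<le> (\<Sum>\<sigma> | \<sigma> permutes (UNIV :: 'n set). \<Prod>i\<in>UNIV. A $ i $ i)"
    unfolding det_def by (intro order_trans[OF sum_abs] sum_mono) auto
  also have "\<dots> = fact CARD('n) * (\<Prod>i\<in>UNIV. A $ i $ i)"
    by (simp add: card_permutations[OF refl])
  finally show ?thesis .
qed

section \<open>Lower bound for the trace in the exponent\<close>

lemma trace_matrix_mult:
  fixes S A :: "real^'n^'n"
  shows "trace (S ** A) = (\<Sum>i\<in>UNIV. \<Sum>j\<in>UNIV. S $ i $ j * A $ j $ i)"
  by (simp add: trace_def matrix_matrix_mult_def)

text \<open>
  Peeling off one rank-one matrix \<open>v v\<^sup>T / A\<^sub>i\<^sub>i\<close>, with \<open>v\<close> the \<open>i\<close>-th column of \<open>A\<close>, leaves a positive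
  semidefinite matrix with fewer nonzero diagonal entries.
\<close>
lemma trace_mult_psd_ge:
  fixes S A :: "real^'n^'n"
  assumes S: "\<And>x. c * (x \<bullet> x) \<le> x \<bullet> (S *v x)"
    and "transpose A = A" and "\<And>x. 0 \<le> x \<bullet> (A *v x)"
  shows "c * trace A \<le> trace (S ** A)"
  using assms(2,3)
proof (induction "card {i. A $ i $ i \<noteq> 0}" arbitrary: A rule: less_induct)
  case less
  note sym = \<open>transpose A = A\<close> and psd = less.prems(2)
  show ?case
  proof (cases "\<exists>i. A $ i $ i \<noteq> 0")
    case False
    \<comment> \<open>A zero diagonal forces every entry to vanish, by the bound on squared
      entries.\<close>
    then have "A = 0" using psd_entry_sq_le[OF sym psd] by (simp add: vec_eq_iff)
    then show ?thesis by (simp add: trace_matrix_mult) (simp add: trace_def)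
  next
    case True
    then obtain i where i: "A $ i $ i \<noteq> 0" by blast
    define a v where "a = A $ i $ i" and "v = A *v axis i 1"
    define B :: "real^'n^'n" where "B = (\<chi> j k. A $ j $ k - v $ j * v $ k / a)"
    have a: "a > 0" using i psd_diag_nonneg[OF psd, of i] by (simp add: a_def)
    have v: "v $ j = A $ j $ i" for j by (simp add: v_def matrix_vector_mult_basis column_def)
    have A_sym: "A $ j $ k = A $ k $ j" for j k
      using sym by (metis transpose_def vec_lambda_beta)
    have symB: "transpose B = B"
      by (simp add: transpose_def B_def vec_eq_iff mult.commute A_sym)
    have qB: "x \<bullet> (B *v x) = x \<bullet> (A *v x) - (x \<bullet> v)\<^sup>2 / a" for x
    proof -
      have "(x \<bullet> v)\<^sup>2 = (\<Sum>j\<in>UNIV. \<Sum>k\<in>UNIV. v $ j * v $ k * x $ j * x $ k)"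
        by (simp add: inner_vec_def power2_eq_square sum_product mult_ac)
      then show ?thesis
        unfolding inner_matrix_vector_sum
        by (simp add: B_def left_diff_distrib sum_subtractf sum_divide_distrib)
    qed
    \<comment> \<open>Cauchy-Schwarz for the form of \<open>A\<close>, between \<open>x\<close> and
      the \<open>i\<close>-th unit vector:
      \<open>(x \<bullet> v)\<^sup>2 \<le> (x \<bullet> (A *v x)) * a\<close>.\<close>
    have psdB: "0 \<le> x \<bullet> (B *v x)" for x
      using psd_cauchy_schwarz[OF sym psd, of x "axis i 1"] a
      unfolding inner_axis_matrix_vector by (simp add: qB field_simps flip: v_def a_def)
    \<comment> \<open>Zero diagonal entries stay zero because \<open>v $ j\<close> vanishes with
      them; together with the new zero at \<open>i\<close>, the induction measure drops.\<close>
    have "B $ j $ j = 0" if "A $ j $ j = 0" for j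
      using psd_entry_sq_le[OF sym psd, of j i] that by (simp add: B_def v)
    moreover have "B $ i $ i = 0" using a by (simp add: B_def v flip: a_def)
    ultimately have "card {j. B $ j $ j \<noteq> 0} < card {j. A $ j $ j \<noteq> 0}"
      using i by (intro psubset_card_mono) auto
    from less.hyps[OF this symB psdB]
    have "c * trace B \<le> trace (S ** B)" .
    moreover have "trace B = trace A - (v \<bullet> v) / a"
      by (simp add: trace_def B_def sum_subtractf inner_vec_def sum_divide_distrib)
    moreover have "trace (S ** B) = trace (S ** A) - (v \<bullet> (S *v v)) / a"
      by (simp add: trace_matrix_mult B_def right_diff_distrib sum_subtractf inner_matrix_vector_sum
          sum_divide_distrib mult_ac)
    \<comment> \<open>The rank-one part: its trace against \<open>S\<close> is the form of
      \<open>S\<close> at \<open>v\<close>, divided by \<open>a\<close>.\<close>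
    moreover have "c * (v \<bullet> v) / a \<le> (v \<bullet> (S *v v)) / a"
      using S a by (simp add: divide_right_mono)
    ultimately show ?thesis by (simp add: algebra_simps)
  qed
qed

section \<open>Positive definite matrices: coercivity and measurability of the cone\<close>

lemma pos_definite_imp_psd: "pos_definite A \<Longrightarrow> 0 \<le> x \<bullet> (A *v x)"
  unfolding pos_definite_def by (cases "x = 0") (auto intro: less_imp_le)

lemma pos_definite_diag_pos: "pos_definite A \<Longrightarrow> 0 < A $ i $ i"
  unfolding pos_definite_def by (metis axis_eq_0_iff inner_axis_matrix_vector zero_neq_one)

text \<open>The constant is the minimum of the form on the unit sphere, attained by compactness and
  positive by definiteness; homogeneity extends the bound to all vectors.\<close>

lemma pos_definite_coercive:
  fixes S :: "'p::finite sqmat"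
  assumes "pos_definite S"
  obtains c where "c > 0" "\<And>x. c * (x \<bullet> x) \<le> x \<bullet> (S *v x)"
proof -
  have "\<exists>z\<in>sphere 0 1. \<forall>x\<in>sphere 0 1. z \<bullet> (S *v z) \<le> x \<bullet> (S *v x)"
    by (intro continuous_attains_inf) (auto intro!: continuous_intros)
  then obtain z where z: "norm z = 1" "\<And>x. norm x = 1 \<Longrightarrow> z \<bullet> (S *v z) \<le> x \<bullet> (S *v x)"
    by auto
  show ?thesis
  proof (rule that)
    show "z \<bullet> (S *v z) > 0" 
      using z(1) assms unfolding pos_definite_def by (metis norm_zero zero_neq_one)
    show "z \<bullet> (S *v z) * (x \<bullet> x) \<le> x \<bullet> (S *v x)" for x
    proof (cases "x = 0")
      case False
      have "z \<bullet> (S *v z) \<le> (x /\<^sub>R norm x) \<bullet> (S *v (x /\<^sub>R norm x))"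
        using False by (intro z) simp
      also have "\<dots> = (x \<bullet> (S *v x)) / (x \<bullet> x)"
        by (simp add: matrix_vector_mult_scaleR divide_simps flip: norm_eq_sqrt_inner)
          (simp add: power2_norm_eq_inner[symmetric] power2_eq_square)
      finally show ?thesis using False by (simp add: field_simps)
    qed simp
  qed
qed

text \<open>The cone is a difference of closed sets: the symmetric matrices minus those whose form
  is nonpositive at some unit vector. The latter set is closed as a projection along the compact
  sphere.\<close>

lemma borel_pos_definite [measurable]: "{A :: 'p::finite sqmat. pos_definite A} \<in> sets borel"
proof -
  let ?T = "{(x, A). x \<bullet> (A *v x) \<le> 0} :: ((real^'p) \<times> 'p sqmat) set"
  have "continuous_on UNIV (\<lambda>(x::real^'p, A::'p sqmat). x \<bullet> (A *v x))"
    unfolding inner_matrix_vector_sum case_prod_unfold by (intro continuous_intros)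
  then have "closed ?T"
    using closed_Collect_le[of "\<lambda>(x::real^'p, A::'p sqmat). x \<bullet> (A *v x)" "\<lambda>_. 0"]
    by (simp add: case_prod_unfold)
  then have "closed {A. \<exists>x. x \<in> sphere 0 1 \<and> (x, A) \<in> ?T}"
    by (intro closed_compact_projection) auto
  moreover have "closed {A :: 'p sqmat. transpose A = A}"
    unfolding transpose_def vec_eq_iff
    by (simp, intro closed_Collect_all closed_Collect_eq continuous_intros)
  moreover have "{A. pos_definite A} =
      {A :: 'p sqmat. transpose A = A} - {A. \<exists>x. x \<in> sphere 0 1 \<and> (x, A) \<in> ?T}"
  proof (intro set_eqI)
    fix A :: "'p sqmat"
    have "x \<bullet> (A *v x) > 0" if *: "\<And>x. norm x = 1 \<Longrightarrow> x \<bullet> (A *v x) > 0" and "x \<noteq> 0" for x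
    proof -
      have "(x /\<^sub>R norm x) \<bullet> (A *v (x /\<^sub>R norm x)) > 0"
        using \<open>x \<noteq> 0\<close> by (intro *) simp
      then show ?thesis using \<open>x \<noteq> 0\<close> by (simp add: matrix_vector_mult_scaleR zero_less_mult_iff)
    qed
    moreover have "x \<noteq> 0" if "norm x = 1" for x :: "real^'p" using that by auto
    ultimately show "A \<in> {A. pos_definite A} \<longleftrightarrow>
        A \<in> {A. transpose A = A} - {A. \<exists>x. x \<in> sphere 0 1 \<and> (x, A) \<in> ?T}"
      by (auto simp: pos_definite_def not_le)
  qed
  ultimately show ?thesis by (auto intro: borel_closed)
qed

section \<open>Integration over the upper triangle\<close>

lemma prod_strict_upper:
  fixes f :: "'p::{finite,linorder} \<Rightarrow> 'a::comm_monoid_mult"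
  shows "(\<Prod>(i, j)\<in>{(i, j). i < j}. f i * f j) = (\<Prod>i\<in>UNIV. f i ^ (CARD('p) - 1))"
proof -
  have "(\<Prod>(i, j)\<in>{(i, j). i < j}. f i * f j) =
      (\<Prod>(i, j)\<in>{(i, j). i < j}. f i) * (\<Prod>(i, j)\<in>{(i, j). i < j}. f j)"
    by (simp add: case_prod_unfold prod.distrib)
  also have "(\<Prod>(i, j)\<in>{(i, j). i < j}. f j) = (\<Prod>(i, j)\<in>{(i, j). j < i}. f i)"
    by (rule prod.reindex_bij_witness[of _ prod.swap prod.swap]) auto
  also have "(\<Prod>(i, j)\<in>{(i, j). i < j}. f i) * (\<Prod>(i, j)\<in>{(i, j). j < i}. f i) =
      (\<Prod>(i, j)\<in>{(i, j). i < j} \<union> {(i, j). j < i}. f i)"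
    by (intro prod.union_disjoint[symmetric]) auto
  \<comment> \<open>Each index has \<open>CARD('p) - 1\<close> partners; this is where the exponent
    comes from.\<close>
  also have "{(i, j). i < j} \<union> {(i, j). j < i} = (SIGMA i:UNIV. UNIV - {i :: 'p})"
    by auto
  also have "(\<Prod>(i, j)\<in>\<dots>. f i) = (\<Prod>i\<in>UNIV. f i ^ (CARD('p) - 1))"
    by (subst prod.Sigma[symmetric]) (auto simp: card_Diff_singleton)
  finally show ?thesis .
qed

text \<open>
  The constraint that the \<open>2 \<times> 2\<close> principal minors impose on an off-diagonal entry; the absolute
  values make it meaningful on the whole product space.
\<close>
definition minor_box :: "('p \<times> 'p \<Rightarrow> real) \<Rightarrow> 'p \<times> 'p \<Rightarrow> real set" where
  "minor_box \<theta> = (\<lambda>(i, j).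
     {- (sqrt \<bar>\<theta> (i, i)\<bar> * sqrt \<bar>\<theta> (j, j)\<bar>)..sqrt \<bar>\<theta> (i, i)\<bar> * sqrt \<bar>\<theta> (j, j)\<bar>})"

lemma measurable_upper_tri_lebesgue_component:
  "i \<le> j \<Longrightarrow> (\<lambda>\<theta>. \<theta> (i, j)) \<in> borel_measurable upper_tri_lebesgue"
  using measurable_component_singleton[of "(i, j)" upper_tri "\<lambda>_. lborel :: real measure"]
  by (simp add: upper_tri_lebesgue_def upper_tri_def)

text \<open>The endpoints vary with the point, as they do in \<open>minor_box\<close>.\<close>

lemma borel_measurable_indicator_Icc:
  fixes e f g :: "'a \<Rightarrow> real"
  assumes [measurable]: "e \<in> borel_measurable M" "f \<in> borel_measurable M" "g \<in> borel_measurable M"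
  shows "(\<lambda>x. indicator {f x..g x} (e x) :: ennreal) \<in> borel_measurable M"
  unfolding indicator_def atLeastAtMost_iff by measurable

lemma borel_measurable_prod_diag_minor_box:
  fixes h :: "real \<Rightarrow> ennreal"
  assumes [measurable]: "h \<in> borel_measurable borel"
  shows "(\<lambda>\<theta>. (\<Prod>i\<in>UNIV. h (\<theta> (i, i))) * (\<Prod>k\<in>{(i, j). i < j}. indicator (minor_box \<theta> k) (\<theta> k)))
    \<in> borel_measurable (upper_tri_lebesgue :: ('p::{finite,linorder} \<times> 'p \<Rightarrow> real) measure)"
proof (intro borel_measurable_times_ennreal borel_measurable_prod_ennreal)
  have [measurable]: "(\<lambda>\<theta>. \<theta> (i, i)) \<in> borel_measurable upper_tri_lebesgue" for i :: 'p
    by (rule measurable_upper_tri_lebesgue_component) simp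
  show "(\<lambda>\<theta>. h (\<theta> (i, i))) \<in> borel_measurable upper_tri_lebesgue" for i :: 'p
    by measurable
  fix k :: "'p \<times> 'p"
  assume "k \<in> {(i, j). i < j}"
  then obtain i j where k: "k = (i, j)" "i < j" by auto
  have [measurable]: "(\<lambda>\<theta>. \<theta> (i, j)) \<in> borel_measurable upper_tri_lebesgue"
    using k by (intro measurable_upper_tri_lebesgue_component) simp
  show "(\<lambda>\<theta>. indicator (minor_box \<theta> k) (\<theta> k) :: ennreal) \<in> borel_measurable upper_tri_lebesgue"
    unfolding k minor_box_def prod.case by (rule borel_measurable_indicator_Icc) measurable
qed

text \<open>Tonelli with the off-diagonal entries innermost. For fixed diagonal their domain is a
  box whose volume is a product over pairs, which regroups into powers of single diagonal entries,
  so the outer integral factorises too.\<close>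

lemma nn_integral_upper_tri:
  fixes h :: "real \<Rightarrow> ennreal"
  assumes [measurable]: "h \<in> borel_measurable borel"
  shows "(\<integral>\<^sup>+ \<theta>. (\<Prod>i\<in>UNIV. h (\<theta> (i, i))) * (\<Prod>k\<in>{(i, j). i < j}. indicator (minor_box \<theta> k) (\<theta> k))
      \<partial>(upper_tri_lebesgue :: ('p::{finite,linorder} \<times> 'p \<Rightarrow> real) measure)) =
    2 ^ card {(i, j :: 'p). i < j} *
      (\<integral>\<^sup>+ x. h x * ennreal (sqrt \<bar>x\<bar>) ^ (CARD('p) - 1) \<partial>lborel) ^ CARD('p)"
    (is "integral\<^sup>N _ ?F = _ * integral\<^sup>N lborel ?g ^ _")
proof -
  let ?D = "(\<lambda>i. (i, i)) ` UNIV :: ('p \<times> 'p) set" and ?O = "{(i, j). i < j} :: ('p \<times> 'p) set"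
  interpret product_sigma_finite "\<lambda>_ :: 'p \<times> 'p. lborel :: real measure"
    by (rule product_sigma_finite.intro) (rule sigma_finite_lborel)
  have U: "upper_tri = ?D \<union> ?O" by (auto simp: upper_tri_def image_iff)
  have "integral\<^sup>N upper_tri_lebesgue ?F =
      (\<integral>\<^sup>+ x. (\<integral>\<^sup>+ y. ?F (merge ?D ?O (x, y)) \<partial>Pi\<^sub>M ?O (\<lambda>_. lborel)) \<partial>Pi\<^sub>M ?D (\<lambda>_. lborel))"
    using borel_measurable_prod_diag_minor_box[OF assms, where 'p='p]
    unfolding upper_tri_lebesgue_def U by (intro product_nn_integral_fold) auto
  also have "\<dots> = (\<integral>\<^sup>+ x. 2 ^ card ?O * (\<Prod>k\<in>?D. ?g (x k)) \<partial>Pi\<^sub>M ?D (\<lambda>_. lborel))"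
  proof (rule nn_integral_cong)
    fix x :: "'p \<times> 'p \<Rightarrow> real"
    let ?s = "\<lambda>i. sqrt \<bar>x (i, i)\<bar>"
    let ?r = "\<lambda>(i, j). ?s i * ?s j"
    \<comment> \<open>The interval endpoints read only diagonal entries, which \<open>merge\<close>
      takes from \<open>x\<close>; in \<open>y\<close> the box is fixed.\<close>
    have "(\<integral>\<^sup>+ y. ?F (merge ?D ?O (x, y)) \<partial>Pi\<^sub>M ?O (\<lambda>_. lborel)) =
        (\<integral>\<^sup>+ y. (\<Prod>i\<in>UNIV. h (x (i, i))) * (\<Prod>k\<in>?O. indicator {- ?r k..?r k} (y k)) \<partial>Pi\<^sub>M ?O (\<lambda>_. lborel))"
      by (intro nn_integral_cong arg_cong2[of _ _ _ _ "(*)"] prod.cong)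
        (auto simp: merge_def minor_box_def)
    also have "\<dots> = (\<Prod>i\<in>UNIV. h (x (i, i))) *
        (\<integral>\<^sup>+ y. (\<Prod>k\<in>?O. indicator {- ?r k..?r k} (y k)) \<partial>Pi\<^sub>M ?O (\<lambda>_. lborel))"
      by (rule nn_integral_cmult) (intro borel_measurable_prod_ennreal, measurable)
    also have "(\<integral>\<^sup>+ y. (\<Prod>k\<in>?O. indicator {- ?r k..?r k} (y k)) \<partial>Pi\<^sub>M ?O (\<lambda>_. lborel)) =
        (\<Prod>k\<in>?O. \<integral>\<^sup>+ t. indicator {- ?r k..?r k} t \<partial>lborel)"
      by (rule product_nn_integral_prod) auto
    also have "\<dots> = (\<Prod>(i, j)\<in>?O. 2 * (ennreal (?s i) * ennreal (?s j)))"
    proof (intro prod.cong refl)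
      fix k :: "'p \<times> 'p"
      have "0 \<le> ?r k" by (simp add: case_prod_unfold)
      then have "(\<integral>\<^sup>+ t. indicator {- ?r k..?r k} t \<partial>lborel) = ennreal (2 * ?r k)"
        by simp
      then show "(\<integral>\<^sup>+ t. indicator {- ?r k..?r k} t \<partial>lborel) =
          (case k of (i, j) \<Rightarrow> 2 * (ennreal (?s i) * ennreal (?s j)))"
        by (simp add: case_prod_unfold ennreal_mult del: nn_integral_indicator)
    qed
    also have "\<dots> = 2 ^ card ?O * (\<Prod>(i, j)\<in>?O. ennreal (?s i) * ennreal (?s j))"
      by (simp add: case_prod_unfold prod.distrib)
    also have "(\<Prod>(i, j)\<in>?O. ennreal (?s i) * ennreal (?s j)) =
        (\<Prod>i\<in>UNIV. ennreal (?s i) ^ (CARD('p) - 1))"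
      by (rule prod_strict_upper)
    \<comment> \<open>The powers of square roots join the diagonal factors \<open>h\<close>.\<close>
    also have "(\<Prod>i\<in>UNIV. h (x (i, i))) * (2 ^ card ?O * \<dots>) = 2 ^ card ?O * (\<Prod>i\<in>UNIV. ?g (x (i, i)))"
      by (simp add: prod.distrib mult_ac)
    also have "(\<Prod>i\<in>UNIV. ?g (x (i, i))) = (\<Prod>k\<in>?D. ?g (x k))"
      by (subst prod.reindex) (auto simp: inj_on_def)
    finally show "(\<integral>\<^sup>+ y. ?F (merge ?D ?O (x, y)) \<partial>Pi\<^sub>M ?O (\<lambda>_. lborel)) =
        2 ^ card ?O * (\<Prod>k\<in>?D. ?g (x k))" .
  qed
  also have "\<dots> = 2 ^ card ?O * (\<integral>\<^sup>+ x. (\<Prod>k\<in>?D. ?g (x k)) \<partial>Pi\<^sub>M ?D (\<lambda>_. lborel))"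
    by (rule nn_integral_cmult) (intro borel_measurable_prod_ennreal, measurable)
  also have "(\<integral>\<^sup>+ x. (\<Prod>k\<in>?D. ?g (x k)) \<partial>Pi\<^sub>M ?D (\<lambda>_. lborel)) = (\<Prod>k\<in>?D. integral\<^sup>N lborel ?g)"
    by (rule product_nn_integral_prod) auto
  also have "\<dots> = integral\<^sup>N lborel ?g ^ CARD('p)"
    by (simp add: card_image inj_on_def)
  finally show ?thesis .
qed

section \<open>The one-dimensional integral, split at 1\<close>

lemma integrable_powr_exp_mult:
  fixes f :: "real \<Rightarrow> real"
  assumes cont: "continuous_on {0<..} f" and nonneg: "\<And>x. x > 0 \<Longrightarrow> f x \<ge> 0"
    and lim: "Limsup at_top (\<lambda>x. ereal (f x)) < \<infinity>"
    and int: "set_integrable lborel {0<..1} (\<lambda>x. x powr s * f x)"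
    and "s \<ge> 0" "a > 0"
  shows "set_integrable lborel {0<..} (\<lambda>x. x powr s * exp (- a * x) * f x)"
proof -
  have meas: "set_borel_measurable lborel {0<..} (\<lambda>x. x powr s * exp (- a * x) * f x)"
    unfolding set_borel_measurable_def
    using borel_measurable_continuous_on_indicator[of "{0<..}" "\<lambda>x. x powr s * exp (- a * x) * f x"]
    by (simp add: cont continuous_intros)
  have meas_on: "set_borel_measurable lborel B (\<lambda>x. x powr s * exp (- a * x) * f x)"
    if "B \<in> sets borel" "B \<subseteq> {0<..}" for B
    using set_borel_measurable_subset[OF meas] that by simp
  \<comment> \<open>The finite limit superior bounds \<open>f\<close> beyond some \<open>T\<close>,
    and continuity bounds it on the compact interval from 1 to \<open>T\<close>, giving one bound on
    all \<open>x \<ge> 1\<close>.\<close>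
  obtain L where L: "Limsup at_top (\<lambda>x. ereal (f x)) < ereal L"
    using lim less_PInf_Ex_of_nat by auto
  then have "eventually (\<lambda>x. ereal (f x) < ereal L) at_top" by (rule Limsup_lessD)
  then obtain T where T: "\<And>x. x \<ge> T \<Longrightarrow> f x < L" by (auto simp: eventually_at_top_linorder)
  have "compact (f ` {1..T})"
    by (intro compact_continuous_image continuous_on_subset[OF cont]) auto
  then obtain M where M: "\<And>x. x \<in> {1..T} \<Longrightarrow> \<bar>f x\<bar> \<le> M"
    by (meson bounded_real compact_imp_bounded imageI)
  have K: "f x \<le> max L M" if "x \<ge> 1" for x
    using T[of x] M[of x] that by (cases "x \<ge> T") (auto simp: max_def)
  \<comment> \<open>Absolute convergence of the Gamma integral at \<open>s + 1\<close> with rate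
    \<open>a\<close>; taking norms makes the integrand real.\<close>
  have "(\<lambda>t. complex_of_real t powr (of_real (s + 1) - 1) / of_real (exp (a * t))) absolutely_integrable_on {0<..}"
    using \<open>s \<ge> 0\<close> \<open>a > 0\<close> by (intro absolutely_integrable_Gamma_integral) auto
  then have "set_integrable lebesgue {0<..} (\<lambda>t. norm (complex_of_real t powr (of_real (s + 1) - 1) / of_real (exp (a * t))))"
    by (rule set_integrable_norm)
  also have "?this \<longleftrightarrow> set_integrable lebesgue {0<..} (\<lambda>t. t powr s * exp (- a * t))"
    by (intro set_integrable_cong refl) (simp add: norm_divide norm_powr_real_powr exp_minus field_simps)
  \<comment> \<open>The Gamma fact concerns the completed measure; a Borel integrand carries it over
    to \<open>lborel\<close>.\<close>
  also have "\<dots> \<longleftrightarrow> set_integrable lborel {0<..} (\<lambda>t. t powr s * exp (- a * t))"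
    unfolding set_integrable_def by (intro integrable_completion) measurable
  finally have "set_integrable lborel {1<..} (\<lambda>t. t powr s * exp (- a * t) * max L M)"
    by (auto intro: set_integrable_subset)
  then have "set_integrable lborel {1<..} (\<lambda>x. x powr s * exp (- a * x) * f x)"
  proof (rule set_integrable_bound)
    show "AE x in lborel. x \<in> {1<..} \<longrightarrow>
        norm (x powr s * exp (- a * x) * f x) \<le> norm (x powr s * exp (- a * x) * max L M)"
      by (intro AE_I2) (auto simp: abs_mult nonneg intro!: mult_left_mono order_trans[OF K])
  qed (rule meas_on, auto)
  moreover have "set_integrable lborel {0<..1} (\<lambda>x. x powr s * exp (- a * x) * f x)"
    using int
  proof (rule set_integrable_bound)
    \<comment> \<open>Near 0 the exponential is at most 1, so the hypothesis itself is the
      majorant.\<close>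
    have "x powr s * exp (- a * x) * f x \<le> x powr s * 1 * f x" if "x > 0" for x
      using that nonneg \<open>a > 0\<close> by (intro mult_mono) auto
    then show "AE x in lborel. x \<in> {0<..1} \<longrightarrow>
        norm (x powr s * exp (- a * x) * f x) \<le> norm (x powr s * f x)"
      by (intro AE_I2) (auto simp: nonneg abs_mult)
  qed (rule meas_on, auto)
  ultimately have "set_integrable lborel ({0<..1} \<union> {1<..}) (\<lambda>x. x powr s * exp (- a * x) * f x)"
    by (intro set_integrable_Un) auto
  also have "{0<..1} \<union> {1<..} = {0::real<..}" by auto
  finally show ?thesis .
qed

section \<open>Measurability and domination of the posterior density\<close>

lemma sym_matrix_nth:
  "sym_matrix \<theta> $ i $ i = \<theta> (i, i)" "i < j \<Longrightarrow> sym_matrix \<theta> $ i $ j = \<theta> (i, j)"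
  by (simp_all add: sym_matrix_def)

lemma measurable_sym_matrix [measurable]:
  "(sym_matrix :: ('p::{finite,linorder} \<times> 'p \<Rightarrow> real) \<Rightarrow> 'p sqmat) \<in> borel_measurable upper_tri_lebesgue"
proof -
  have "(\<lambda>\<theta>. sym_matrix \<theta> $ i $ j) \<in> borel_measurable upper_tri_lebesgue" for i j :: 'p
    unfolding sym_matrix_def vec_lambda_beta
    by (rule measurable_upper_tri_lebesgue_component) (auto simp: min_def max_def)
  then show ?thesis
    by (subst borel_measurable_euclidean_space) (auto simp: Basis_vec_def inner_axis)
qed

text \<open>
  No regularity of \<open>\<pi>D\<close> on \<open>(-\<infinity>, 0]\<close> is assumed, so it is cut off there first; positive
  definite matrices do not see the cut-off.
\<close>
lemma borel_measurable_posterior_density: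
  fixes S :: "'p::{finite,linorder} sqmat"
  assumes "continuous_on {0<..} \<pi>D" and "continuous_on UNIV \<pi>"
  shows "posterior_density n S \<pi>D \<pi> \<in> borel_measurable borel"
proof -
  let ?f = "\<lambda>x. indicator {0<..} x * \<pi>D x"
  have f [measurable]: "?f \<in> borel_measurable borel"
    using borel_measurable_continuous_on_indicator[OF _ assms(1)] by simp
  have [measurable]: "\<pi> \<in> borel_measurable borel"
    using assms(2) by (rule borel_measurable_continuous_onI)
  have [measurable]: "(\<lambda>A :: 'p sqmat. A $ i $ j) \<in> borel_measurable borel" for i j
    by (intro borel_measurable_continuous_onI continuous_intros)
  have [measurable]: "(\<lambda>A :: 'p sqmat. det A) \<in> borel_measurable borel"
    "(\<lambda>A :: 'p sqmat. trace (S ** A)) \<in> borel_measurable borel"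
    unfolding det_def trace_matrix_mult by measurable
  let ?g = "(\<lambda>\<Theta> :: 'p sqmat. det \<Theta> powr (real n / 2) * exp (- (real n / 2) * trace (S ** \<Theta>)) *
      ((\<Prod>i\<in>UNIV. ?f (\<Theta> $ i $ i)) * (\<Prod>k\<in>{(i, j). i < j}. \<pi> (\<Theta> $ fst k $ snd k)) *
       indicator {A. pos_definite A} \<Theta>))"
  have "?g \<in> borel_measurable borel"
    by measurable
  also have "?g = posterior_density n S \<pi>D \<pi>"
    by (auto simp: fun_eq_iff posterior_density_def prior_density_def case_prod_unfold
        indicator_def pos_definite_diag_pos intro!: prod.cong)
  finally show ?thesis .
qed

text \<open>Determinant, exponential and off-diagonal prior are bounded separately. The resulting
  majorant factorises over the diagonal, the form that \<open>nn_integral_upper_tri\<close>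
  integrates.\<close>

lemma posterior_density_le:
  fixes S :: "'p::{finite,linorder} sqmat" and n :: nat
  defines "I \<equiv> {(i, j :: 'p). i < j}"
  assumes S: "\<And>x. c * (x \<bullet> x) \<le> x \<bullet> (S *v x)"
    and \<pi>D: "\<And>x. x > 0 \<Longrightarrow> \<pi>D x \<ge> 0" and \<pi>: "\<And>x. 0 \<le> \<pi> x" "\<And>x. \<pi> x \<le> M"
    and pd: "pos_definite A"
  shows "posterior_density n S \<pi>D \<pi> A \<le> fact CARD('p) powr (n / 2) * M ^ card I *
      (\<Prod>i\<in>UNIV. A $ i $ i powr (n / 2) * exp (- (n / 2 * c) * A $ i $ i) * \<pi>D (A $ i $ i))"
proof -
  have sym: "transpose A = A" using pd by (simp add: pos_definite_def)
  note psd = pos_definite_imp_psd[OF pd] and pos = pos_definite_diag_pos[OF pd]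
  \<comment> \<open>As \<open>ln (- x) = ln x\<close> for reals, \<open>powr\<close> sees only the
    absolute value of its base, so the bound on \<open>\<bar>det A\<bar>\<close> applies
    directly.\<close>
  have "det A powr (n / 2) = \<bar>det A\<bar> powr (n / 2)" by (simp add: powr_def abs_if ln_minus)
  also have "\<dots> \<le> (fact CARD('p) * (\<Prod>i\<in>UNIV. A $ i $ i)) powr (n / 2)"
    by (intro powr_mono2 psd_abs_det_le sym psd) auto
  also have "\<dots> = fact CARD('p) powr (n / 2) * (\<Prod>i\<in>UNIV. A $ i $ i powr (n / 2))"
    by (simp add: powr_mult prod_nonneg prod_powr_distrib less_imp_le[OF pos])
  finally have det: "det A powr (n / 2) \<le> \<dots>" .
  have "exp (- (n / 2) * trace (S ** A)) \<le> exp (- (n / 2) * (c * trace A))"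
    using trace_mult_psd_ge[OF S sym psd] by (simp add: mult_left_mono)
  also have "\<dots> = (\<Prod>i\<in>UNIV. exp (- (n / 2 * c) * A $ i $ i))"
    by (simp add: trace_def sum_distrib_left mult.assoc flip: exp_sum sum_negf)
  finally have exp: "exp (- (n / 2) * trace (S ** A)) \<le> \<dots>" .
  have "(\<Prod>(i, j)\<in>I. \<pi> (A $ i $ j)) \<le> (\<Prod>k\<in>I. M)"
    by (intro prod_mono) (auto simp: \<pi>)
  then have off: "(\<Prod>(i, j)\<in>I. \<pi> (A $ i $ j)) \<le> M ^ card I" by simp
  have "posterior_density n S \<pi>D \<pi> A = det A powr (n / 2) * exp (- (n / 2) * trace (S ** A)) *
      ((\<Prod>i\<in>UNIV. \<pi>D (A $ i $ i)) * (\<Prod>(i, j)\<in>I. \<pi> (A $ i $ j)))"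
    using pd by (simp add: posterior_density_def prior_density_def I_def)
  also have "\<dots> \<le> (fact CARD('p) powr (n / 2) * (\<Prod>i\<in>UNIV. A $ i $ i powr (n / 2))) *
      (\<Prod>i\<in>UNIV. exp (- (n / 2 * c) * A $ i $ i)) * ((\<Prod>i\<in>UNIV. \<pi>D (A $ i $ i)) * M ^ card I)"
    by (intro mult_mono det exp off order_refl mult_nonneg_nonneg prod_nonneg)
      (auto simp: \<pi>D \<pi> pos split: prod.splits)
  also have "\<dots> = fact CARD('p) powr (n / 2) * M ^ card I *
      (\<Prod>i\<in>UNIV. A $ i $ i powr (n / 2) * exp (- (n / 2 * c) * A $ i $ i) * \<pi>D (A $ i $ i))"
    by (simp add: prod.distrib mult_ac)
  finally show ?thesis .
qed

section \<open>Properness by comparison with an integrable majorant\<close>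

theorem proposition12:
  fixes S :: "'p::{finite,linorder} sqmat"
    and n :: nat
    and \<pi>D \<pi> :: "real \<Rightarrow> real"
  assumes "continuous_on {0<..} \<pi>D" and "\<And>x. x > 0 \<Longrightarrow> \<pi>D x \<ge> 0"
    and "continuous_on UNIV \<pi>" and "\<And>x. \<pi> x \<ge> 0"
    and "pos_definite S"
    and "n \<ge> 1"
    and "bounded (range \<pi>)"
    and "Limsup at_top (\<lambda>x. ereal (\<pi>D x)) < \<infinity>"
    and "set_integrable lborel {0<..1}
           (\<lambda>x. x powr ((real n + real CARD('p) - 1) / 2) * \<pi>D x)"
  shows "posterior_proper n S \<pi>D \<pi>"
proof -
  obtain c where c: "c > 0" "\<And>x. c * (x \<bullet> x) \<le> x \<bullet> (S *v x)"
    using pos_definite_coercive[OF \<open>pos_definite S\<close>] by blast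
  obtain M where M: "\<And>x. \<bar>\<pi> x\<bar> \<le> M"
    using \<open>bounded (range \<pi>)\<close> by (auto simp: bounded_real)
  then have \<pi>_le: "\<pi> x \<le> M" for x by (meson abs_le_D1)
  define I where "I = {(i, j :: 'p). i < j}"
  define C where "C = fact CARD('p) powr (n / 2) * M ^ card I"
  define a where "a = n / 2 * c"
  \<comment> \<open>The exponent adds \<open>n / 2\<close> from the determinant and
    \<open>(CARD('p) - 1) / 2\<close> from the box volumes.\<close>
  define s where "s = (real n + real CARD('p) - 1) / 2"
  \<comment> \<open>The cut-off at 0 makes \<open>g\<close> nonnegative and Borel on the whole line,
    over which each diagonal entry ranges in the product measure.\<close>
  define g where "g x = indicator {0<..} x * (x powr (n / 2) * exp (- a * x) * \<pi>D x)" for x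
  \<comment> \<open>This makes the natural-number difference \<open>CARD('p) - 1\<close> agree with
    the real one below.\<close>
  have p: "real CARD('p) \<ge> 1" using zero_less_card_finite[where 'a='p] by linarith
  then have "s \<ge> 0" unfolding s_def by (intro divide_nonneg_pos) linarith+
  have "a > 0" using c \<open>n \<ge> 1\<close> by (simp add: a_def)
  have "M \<ge> 0" using \<pi>_le[of 0] assms(4)[of 0] by linarith
  then have "C \<ge> 0" by (simp add: C_def)
  have g_nonneg: "g x \<ge> 0" for x using assms(2) by (simp add: g_def indicator_def)
  have g_meas: "g \<in> borel_measurable borel"
    unfolding g_def
    using borel_measurable_continuous_on_indicator[of "{0<..}" "\<lambda>x. x powr (n / 2) * exp (- a * x) * \<pi>D x"]
    by (simp add: assms(1) continuous_intros)
  have "(\<integral>\<^sup>+ x. ennreal (g x) * ennreal (sqrt \<bar>x\<bar>) ^ (CARD('p) - 1) \<partial>lborel) =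
      (\<integral>\<^sup>+ x. ennreal (indicator {0<..} x *\<^sub>R (x powr s * exp (- a * x) * \<pi>D x)) \<partial>lborel)"
  proof (intro nn_integral_cong)
    fix x :: real
    have "g x * sqrt \<bar>x\<bar> ^ (CARD('p) - 1) = indicator {0<..} x *\<^sub>R (x powr s * exp (- a * x) * \<pi>D x)"
    proof (cases "x > 0")
      case True
      have "sqrt \<bar>x\<bar> ^ (CARD('p) - 1) = x powr ((real CARD('p) - 1) / 2)"
        using True p by (simp add: powr_half_sqrt[symmetric] powr_powr of_nat_diff flip: powr_realpow)
      moreover have "x powr s = x powr (n / 2) * x powr ((real CARD('p) - 1) / 2)"
        by (simp add: s_def diff_divide_distrib add_divide_distrib add_diff_eq flip: powr_add)
      ultimately show ?thesis using True by (simp add: g_def)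
    qed (simp add: g_def)
    then show "ennreal (g x) * ennreal (sqrt \<bar>x\<bar>) ^ (CARD('p) - 1) =
        ennreal (indicator {0<..} x *\<^sub>R (x powr s * exp (- a * x) * \<pi>D x))"
      by (simp add: g_nonneg ennreal_power flip: ennreal_mult)
  qed
  also have "\<dots> < \<infinity>"
  proof -
    have "set_integrable lborel {0<..} (\<lambda>x. x powr s * exp (- a * x) * \<pi>D x)"
      using assms(1,2,8,9) \<open>s \<ge> 0\<close> \<open>a > 0\<close> unfolding s_def by (rule integrable_powr_exp_mult)
    then show ?thesis
      unfolding set_integrable_def real_integrable_def by (simp add: less_top)
  qed
  finally have fin: "(\<integral>\<^sup>+ x. ennreal (g x) * ennreal (sqrt \<bar>x\<bar>) ^ (CARD('p) - 1) \<partial>lborel) < \<infinity>" .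

  have bound: "ennreal (norm (posterior_density n S \<pi>D \<pi> (sym_matrix \<theta>))) \<le>
      ennreal C * ((\<Prod>i\<in>UNIV. ennreal (g (\<theta> (i, i)))) * (\<Prod>k\<in>I. indicator (minor_box \<theta> k) (\<theta> k)))"
    (is "_ \<le> ?B \<theta>") for \<theta> :: "'p \<times> 'p \<Rightarrow> real"
  proof (cases "pos_definite (sym_matrix \<theta> :: 'p sqmat)")
    case False
    then show ?thesis by (simp add: posterior_density_def prior_density_def)
  next
    case pd: True
    let ?A = "sym_matrix \<theta> :: 'p sqmat"
    have pos: "\<theta> (i, i) > 0" for i
      using pos_definite_diag_pos[OF pd, of i] by (simp add: sym_matrix_nth)
    have "\<theta> (i, j) \<in> minor_box \<theta> (i, j)" if "i < j" for i j
      using psd_abs_entry_le[OF _ pos_definite_imp_psd[OF pd], of i j] pd pos[of i] pos[of j] that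
      by (simp add: pos_definite_def sym_matrix_nth minor_box_def abs_le_iff)
    \<comment> \<open>On the cone every off-diagonal entry lies in its box, so the indicators in the
      majorant cost nothing there; off the cone the density is zero.\<close>
    then have box: "(\<Prod>k\<in>I. indicator (minor_box \<theta> k) (\<theta> k) :: ennreal) = 1"
      by (intro prod.neutral) (auto simp: I_def)
    have "posterior_density n S \<pi>D \<pi> ?A \<ge> 0"
      unfolding posterior_density_def prior_density_def
      by (intro mult_nonneg_nonneg prod_nonneg) (auto simp: assms(2,4) pos sym_matrix_nth)
    then have "norm (posterior_density n S \<pi>D \<pi> ?A) = posterior_density n S \<pi>D \<pi> ?A" by simp
    also have "\<dots> \<le> C * (\<Prod>i\<in>UNIV. g (\<theta> (i, i)))"
      using posterior_density_le[of c S \<pi>D \<pi> M, OF c(2) assms(2,4) \<pi>_le pd, of n]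
      by (simp add: C_def I_def a_def g_def pos sym_matrix_nth)
    finally have "ennreal (norm (posterior_density n S \<pi>D \<pi> ?A)) \<le> ennreal (C * (\<Prod>i\<in>UNIV. g (\<theta> (i, i))))"
      by (rule ennreal_leI)
    also have "\<dots> = ?B \<theta>"
      using \<open>C \<ge> 0\<close> by (simp add: box ennreal_mult prod_nonneg g_nonneg prod_ennreal)
    finally show ?thesis .
  qed
  \<comment> \<open>The majorant integrates to a constant times a power of the one-dimensional
    integral in \<open>fin\<close>.\<close>
  have "integral\<^sup>N upper_tri_lebesgue ?B = ennreal C * (2 ^ card I *
      (\<integral>\<^sup>+ x. ennreal (g x) * ennreal (sqrt \<bar>x\<bar>) ^ (CARD('p) - 1) \<partial>lborel) ^ CARD('p))"
  proof -
    have h: "(\<lambda>x. ennreal (g x)) \<in> borel_measurable borel" using g_meas by measurable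
    show ?thesis
      using nn_integral_cmult[OF borel_measurable_prod_diag_minor_box[OF h, where 'p='p], of "ennreal C"]
      unfolding I_def nn_integral_upper_tri[OF h] .
  qed
  also have "\<dots> < \<infinity>"
    using fin by (simp add: ennreal_mult_less_top power_less_top_ennreal)
  finally have "(\<integral>\<^sup>+ \<theta>. ennreal (norm (posterior_density n S \<pi>D \<pi> (sym_matrix \<theta>))) \<partial>upper_tri_lebesgue) < \<infinity>"
    by (rule le_less_trans[OF nn_integral_mono[OF bound]])
  moreover have "(\<lambda>\<theta>. posterior_density n S \<pi>D \<pi> (sym_matrix \<theta>)) \<in> borel_measurable upper_tri_lebesgue"
    by (rule measurable_compose[OF measurable_sym_matrix borel_measurable_posterior_density[OF assms(1,3)]])
  ultimately show ?thesis
    unfolding posterior_proper_def by (simp add: integrable_iff_bounded)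
qed

end
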